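(* Let $K$ be a commutative field, $n=2^k$ with $k\in\mathbb N$, $\omega\in K$ a primitive $n$-th root of unity, $1\leqslant l\leqslant n$, and $(a_0,\dots,a_{l-1})\in K^l$. Let $n_1=2^{k_1}\leqslant l$, $n_2=2^{k_2}:=n/n_1$, $\lambda:=\lceil l/n_1\rceil$, and $A(X):=a_0+a_1X+\cdots+a_{l-1}X^{l-1}$; set $a_i:=0$ for $l\leqslant i\leqslant n-1$. Consider the following algorithm. 1. Let $b_{j_2}:=(a_{j_2n_1},\dots,a_{(j_2+1)n_1-1})\in K^{n_1}$ for all $j_2\in\{0,\dots,\lambda-1\}$. Compute $(\hat b_{[0]_{k_2}},\dots,\hat b_{[\lambda-1]_{k_2}}):=\mathrm{TFT}_{\omega^{n_1}}(b_0,\dots,b_{\lambda-1})$ over the vector space $K^{n_1}$. 2. Let $c_{j_1}:=\left(\hat b_{[0]_{k_2},j_1}\omega^{j_1[0]_{k_2}},\ \hat b_{[1]_{k_2},j_1}\omega^{j_1[1]_{k_2}},\dots,\hat b_{[\lambda-1]_{k_2},j_1}\omega^{j_1[\lambda-1]_{k_2}}\right)\in K^\lambda$ for all $j_1\in\{0,\dots,n_1-1\}$. 3. Compute $(\hat c_{[0]_{k_1}},\dots,\hat c_{[n_1-1]_{k_1}}):=\mathrm{TFT}_{\omega^{n_2}}(c_0,\dots,c_{n_1-1})$ over the vector space $K^\lambda$. 4. Return $\left(\hat c_{[0]_{k_1},0},\dots,\hat c_{[n_1-1]_{k_1},0},\ \hat c_{[0]_{k_1},1},\dots,\hat c_{[n_1-1]_{k_1},1},\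 \dots,\ \hat c_{[0]_{k_1},\lambda-1},\dots,\hat c_{[n_1-1]_{k_1},\lambda-1}\right)$. Then the algorithm is correct: it returns the sequence of values $A(\omega^{[i]_k})$ for $i=0,1,\dots,\lambda n_1-1$, in this order. Moreover it takes at most $\frac32\,\lambda\, n_1\, k+O(n)$ operations in $K$ (with an absolute implied constant), assuming that all the powers of $\omega$ are given.
   Context: For $i\in\{0,\dots,2^k-1\}$ with binary expansion $i=i_0+i_12+\cdots+i_{k-1}2^{k-1}$, the bitwise mirror of $i$ in length $k$ is $[i]_k:=i_{k-1}+i_{k-2}2+\cdots+i_02^{k-1}$. A primitive $N$-th root of unity $\theta\in K$ satisfies $\theta^N=1$ and $\theta^j\neq1$ for $1\leqslant j\leqslant N-1$. If $\mathcal A$ is a $K$-vector space, $N=2^\kappa$, $\theta$ is a primitive $N$-th root of unity and $L\leqslant N$, the truncated Fourier transform of $(x_0,\dots,x_{L-1})\in\mathcal A^L$ with respect to $\theta$ is $\mathrm{TFT}_\theta(x):=(\hat x_{[0]_\kappa},\dots,\hat x_{[L-1]_\kappa})\in\mathcal A^L$, where $\hat x_i:=\sum_{j=0}^{L-1}\theta^{ij}x_j$. For a vector $\hat b_i\in K^{n_1}$ (resp. $\hat c_i\in K^\lambda$), $\hat b_{i,j}$ (resp. $\hat c_{i,j}$) denotes its coordinate of index $j$, with indices starting at $0$. "Operations in $K$" means additions, subtractions and multiplications in $K$. The TFTs in steps 1 and 3 are performed coordinatewise with van der Hoeven's truncated Fourier transform algorithm (a known result, taken as a subroutine), which computes a TFT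 of length $L\leqslant N=2^\kappa$ over $K$ using at most $\frac32(L\kappa+N)+\frac12$ operations in $K$, the powers of $\theta$ being given. *)

theory Defs
  imports
    Complex_Main
    "HOL-Computational_Algebra.Polynomial"
    "HOL-Library.State_Monad"
begin

definition mirror :: "nat \<Rightarrow> nat \<Rightarrow> nat" where
  "mirror k i = (\<Sum>t<k. of_bool (bit i t) * 2 ^ (k - 1 - t))"

definition primitive_root_of_unity :: "nat \<Rightarrow> 'a::field \<Rightarrow> bool" where
  "primitive_root_of_unity N \<theta> \<longleftrightarrow> \<theta> ^ N = 1 \<and> (\<forall>j\<in>{1..N - 1}. \<theta> ^ j \<noteq> 1)"

definition dft_coeff :: "'a::field \<Rightarrow> 'a list \<Rightarrow> nat \<Rightarrow> 'a" where
  "dft_coeff \<theta> x i = (\<Sum>j<length x. \<theta> ^ (i * j) * x ! j)"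

definition TFT :: "nat \<Rightarrow> 'a::field \<Rightarrow> 'a list \<Rightarrow> 'a list" where
  "TFT \<kappa> \<theta> x = map (\<lambda>p. dft_coeff \<theta> x (mirror \<kappa> p)) [0..<length x]"


text \<open>
  Algorithms counting operations in a field are straight-line programs: lists of instructions,
  each applied to inputs, results of earlier instructions, given powers of the root of unity,
  or the constant 0. Only the arithmetic instructions are counted. Programs do not mention
  the field, so their operation counts cannot depend on it; the field and the root of unity are
  supplied when a program is run.
\<close>

datatype operand =
    Input nat
  | Result nat \<comment> \<open>result of the instruction of that index, counting from 0\<close>
  | Root nat \<comment> \<open>power of the root of unity with that exponent\<close>
  | Zero

datatype instr = Add operand operand | Sub operand operand | Mul operand operand

datatype slp = SLP (instrs: "instr list") (outputs: "operand list")

definition slp_ops :: "slp \<Rightarrow> nat" where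
  "slp_ops P = length (instrs P)"

fun operand_val :: "'a::field \<Rightarrow> 'a list \<Rightarrow> 'a list \<Rightarrow> operand \<Rightarrow> 'a" where
  "operand_val \<theta> x rs (Input i) = x ! i"
| "operand_val \<theta> x rs (Result t) = rs ! t"
| "operand_val \<theta> x rs (Root e) = \<theta> ^ e"
| "operand_val \<theta> x rs Zero = 0"

fun instr_val :: "'a::field \<Rightarrow> 'a list \<Rightarrow> 'a list \<Rightarrow> instr \<Rightarrow> 'a" where
  "instr_val \<theta> x rs (Add u v) = operand_val \<theta> x rs u + operand_val \<theta> x rs v"
| "instr_val \<theta> x rs (Sub u v) = operand_val \<theta> x rs u - operand_val \<theta> x rs v"
| "instr_val \<theta> x rs (Mul u v) = operand_val \<theta> x rs u * operand_val \<theta> x rs v"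

definition exec :: "'a::field \<Rightarrow> 'a list \<Rightarrow> instr list \<Rightarrow> 'a list" where
  "exec \<theta> x is = foldl (\<lambda>rs i. rs @ [instr_val \<theta> x rs i]) [] is"

definition slp_run :: "'a::field \<Rightarrow> slp \<Rightarrow> 'a list \<Rightarrow> 'a list" where
  "slp_run \<theta> P x = map (operand_val \<theta> x (exec \<theta> x (instrs P))) (outputs P)"

fun operand_ok :: "nat \<Rightarrow> nat \<Rightarrow> operand \<Rightarrow> bool" where
  "operand_ok m t (Input i) \<longleftrightarrow> i < m"
| "operand_ok m t (Result s) \<longleftrightarrow> s < t"
| "operand_ok m t (Root e) \<longleftrightarrow> True"
| "operand_ok m t Zero \<longleftrightarrow> True"

fun instr_ok :: "nat \<Rightarrow> nat \<Rightarrow> instr \<Rightarrow> bool" where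
  "instr_ok m t (Add u v) \<longleftrightarrow> operand_ok m t u \<and> operand_ok m t v"
| "instr_ok m t (Sub u v) \<longleftrightarrow> operand_ok m t u \<and> operand_ok m t v"
| "instr_ok m t (Mul u v) \<longleftrightarrow> operand_ok m t u \<and> operand_ok m t v"

text \<open>A program on \<open>m\<close> inputs may only refer to existing inputs and to earlier results.\<close>

definition slp_wf :: "nat \<Rightarrow> slp \<Rightarrow> bool" where
  "slp_wf m P \<longleftrightarrow> (\<forall>t<length (instrs P). instr_ok m t (instrs P ! t)) \<and>
     (\<forall>u\<in>set (outputs P). operand_ok m (length (instrs P)) u)"

definition slp_computes_TFT :: "nat \<Rightarrow> nat \<Rightarrow> 'a::field \<Rightarrow> slp \<Rightarrow> bool" where
  "slp_computes_TFT \<kappa> L \<theta> P \<longleftrightarrow>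
     slp_wf L P \<and> (\<forall>x. length x = L \<longrightarrow> slp_run \<theta> P x = TFT \<kappa> \<theta> x)"


text \<open>Programs are assembled in a state monad whose state is the code emitted so far.\<close>

type_synonym 'r gen = "(instr list, 'r) state"

definition emit :: "instr \<Rightarrow> operand gen" where
  "emit i = do {
     is \<leftarrow> State_Monad.get;
     State_Monad.set (is @ [i]);
     State_Monad.return (Result (length is))
   }"

text \<open>
  Inlining a subroutine that is to be run with the root of unity \<open>\<omega> ^ s\<close>: its inputs become the
  arguments, its results are renumbered after the \<open>r\<close> existing ones, and its powers of \<open>\<omega> ^ s\<close> are
  looked up among the powers of \<open>\<omega>\<close>.
\<close>

fun relocate :: "nat \<Rightarrow> nat \<Rightarrow> operand list \<Rightarrow> operand \<Rightarrow> operand" where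
  "relocate s r args (Input i) = args ! i"
| "relocate s r args (Result t) = Result (r + t)"
| "relocate s r args (Root e) = Root (s * e)"
| "relocate s r args Zero = Zero"

fun relocate_instr :: "nat \<Rightarrow> nat \<Rightarrow> operand list \<Rightarrow> instr \<Rightarrow> instr" where
  "relocate_instr s r args (Add u v) = Add (relocate s r args u) (relocate s r args v)"
| "relocate_instr s r args (Sub u v) = Sub (relocate s r args u) (relocate s r args v)"
| "relocate_instr s r args (Mul u v) = Mul (relocate s r args u) (relocate s r args v)"

definition call :: "nat \<Rightarrow> slp \<Rightarrow> operand list \<Rightarrow> operand list gen" where
  "call s P args = do {
     is \<leftarrow> State_Monad.get;
     State_Monad.set (is @ map (relocate_instr s (length is) args) (instrs P));
     State_Monad.return (map (relocate s (length is) args) (outputs P))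
   }"

definition gen_slp :: "operand list gen \<Rightarrow> slp" where
  "gen_slp g = (case run_state g [] of (outs, is) \<Rightarrow> SLP is outs)"


definition num_blocks :: "nat \<Rightarrow> nat \<Rightarrow> nat" where
  "num_blocks l n1 = nat \<lceil>real l / real n1\<rceil>"

definition coeff_operand :: "nat \<Rightarrow> nat \<Rightarrow> operand" where
  "coeff_operand l i = (if i < l then Input i else Zero)"

text \<open>
  \<open>tft \<kappa> L\<close> is the subroutine for transforms of length \<open>L \<le> 2 ^ \<kappa>\<close> over the base field.
  The transforms over \<open>K ^ n1\<close> and \<open>K ^ m\<close> are done coordinate by coordinate, so
  \<open>bhat ! j1 ! p\<close> is the coordinate of index \<open>j1\<close> of the vector at position \<open>p\<close> (index
  \<open>mirror k2 p\<close>) of the first transform, and \<open>chat ! p ! q\<close> is the coordinate of index \<open>p\<close> of the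
  vector at position \<open>q\<close> (index \<open>mirror k1 q\<close>) of the second.
\<close>

definition block_TFT :: "(nat \<Rightarrow> nat \<Rightarrow> slp) \<Rightarrow> nat \<Rightarrow> nat \<Rightarrow> nat \<Rightarrow> slp" where
  "block_TFT tft k k1 l =
    (let k2 = k - k1; n1 = 2 ^ k1; n2 = 2 ^ k2; m = num_blocks l n1 in
     gen_slp (do {
       bhat \<leftarrow> traverse_list
         (\<lambda>j1. call n1 (tft k2 m) (map (\<lambda>j2. coeff_operand l (j2 * n1 + j1)) [0..<m]))
         [0..<n1];
       c \<leftarrow> traverse_list
         (\<lambda>j1. traverse_list
            (\<lambda>p. emit (Mul (bhat ! j1 ! p) (Root (j1 * mirror k2 p)))) [0..<m])
         [0..<n1];
       chat \<leftarrow> traverse_list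
         (\<lambda>p. call n2 (tft k1 n1) (map (\<lambda>j1. c ! j1 ! p) [0..<n1]))
         [0..<m];
       State_Monad.return (concat chat)
     }))"

end

theory Submission
  imports Defs
begin

text \<open>
  Splitting the coefficient index as \<open>j2 * n1 + j1\<close> turns evaluation of \<open>A\<close> at a power of
  \<open>\<omega>\<close> into a transform in \<open>j2\<close>, a twiddle factor and a transform in \<open>j1\<close>; bit reversal of
  \<open>p * n1 + q\<close> splits accordingly into the bit reversals of \<open>p\<close> and \<open>q\<close>. That the emitted code
  performs these steps is shown with a Hoare-style logic for code generators whose assertions
  say which values the operands denote; these survive appending further code, because results are
  only ever added. The cost is exactly \<open>n1\<close> transforms of length \<open>m\<close>, \<open>m * n1\<close> twiddle
  multiplications and \<open>m\<close> transforms of length \<open>n1\<close>; with \<open>m * n1 \<le> n\<close> everything but the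
  leading term sums to at most \<open>5 * n\<close>.
\<close>

section \<open>Bit reversal and roots of unity\<close>

lemma sum_lessThan_add:
  fixes f :: "nat \<Rightarrow> 'a::comm_monoid_add"
  shows "(\<Sum>i<m + n. f i) = (\<Sum>i<m. f i) + (\<Sum>i<n. f (m + i))"
  by (induction n) (simp_all add: add.assoc)

text \<open>The low \<open>k1\<close> bits of \<open>p * 2 ^ k1 + q\<close> are those of
  \<open>q\<close> and the later ones those of \<open>p\<close>; reversal exchanges the two groups,
  so the bits of \<open>q\<close> acquire the weights from \<open>2 ^ k2\<close> upwards.\<close>

lemma mirror_block:
  assumes "q < 2 ^ k1"
  shows "mirror (k2 + k1) (p * 2 ^ k1 + q) = mirror k2 p + 2 ^ k2 * mirror k1 q"
proof -
  have low: "bit (p * 2 ^ k1 + q) t \<longleftrightarrow> bit q t" if "t < k1" for t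
  proof -
    have "take_bit k1 (p * 2 ^ k1 + q) = take_bit k1 q"
      by (simp add: take_bit_eq_mod)
    then show ?thesis
      using that by (metis bit_take_bit_iff)
  qed
  have high: "bit (p * 2 ^ k1 + q) (k1 + t) \<longleftrightarrow> bit p t" for t
  proof -
    have "drop_bit k1 (p * 2 ^ k1 + q) = p"
      using assms by (simp add: drop_bit_eq_div)
    then show ?thesis
      by (metis bit_drop_bit_eq comp_apply)
  qed
  have "mirror (k2 + k1) (p * 2 ^ k1 + q) =
      (\<Sum>t<k1. of_bool (bit (p * 2 ^ k1 + q) t) * 2 ^ (k1 + k2 - 1 - t)) +
      (\<Sum>t<k2. of_bool (bit (p * 2 ^ k1 + q) (k1 + t)) * 2 ^ (k1 + k2 - 1 - (k1 + t)))"
    unfolding mirror_def add.commute[of k2 k1] by (rule sum_lessThan_add)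
  \<comment> \<open>Here \<open>t < k1\<close>, so the truncated exponent equals
    \<open>k2 + (k1 - 1 - t)\<close> and the factor \<open>2 ^ k2\<close> splits off.\<close>
  also have "(\<Sum>t<k1. of_bool (bit (p * 2 ^ k1 + q) t) * 2 ^ (k1 + k2 - 1 - t)) =
      2 ^ k2 * mirror k1 q"
    unfolding mirror_def sum_distrib_left
    by (intro sum.cong) (auto simp: low simp flip: power_add intro!: arg_cong[of _ _ "(^) 2"])
  also have "(\<Sum>t<k2. of_bool (bit (p * 2 ^ k1 + q) (k1 + t)) * 2 ^ (k1 + k2 - 1 - (k1 + t))) =
      mirror k2 p"
    unfolding mirror_def by (intro sum.cong) (auto simp: high)
  finally show ?thesis
    by simp
qed

lemma primitive_root_of_unity_power:
  assumes "primitive_root_of_unity (N * M) \<omega>" "N > 0"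
  shows "primitive_root_of_unity M (\<omega> ^ N)"
  unfolding primitive_root_of_unity_def
proof (intro conjI ballI)
  show "(\<omega> ^ N) ^ M = 1"
    using assms by (simp add: primitive_root_of_unity_def flip: power_mult)
  fix j assume j: "j \<in> {1..M - 1}"
  then have "N * j < N * M"
    using assms(2) by auto
  moreover have "0 < N * j"
    using j assms(2) by simp
  ultimately have "N * j \<in> {1..N * M - 1}"
    unfolding atLeastAtMost_iff by linarith
  then show "(\<omega> ^ N) ^ j \<noteq> 1"
    using assms(1) unfolding primitive_root_of_unity_def power_mult[symmetric] by blast
qed

section \<open>Polynomial values as sums and block decompositions of index ranges\<close>

lemma poly_Poly_sum:
  fixes z :: "'a::comm_semiring_1"
  shows "poly (Poly a) z = (\<Sum>i<length a. a ! i * z ^ i)"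
  by (induction a)
    (simp_all add: sum.lessThan_Suc_shift sum_distrib_left mult.left_commute
      del: sum.lessThan_Suc)

lemma sum_blocks_mod:
  fixes f :: "nat \<Rightarrow> 'a::comm_monoid_add"
  shows "(\<Sum>i<n. \<Sum>j<m. f (j * n + i)) = (\<Sum>i<m * n. f i)"
proof -
  have "(\<Sum>i<n. \<Sum>j<m. f (j * n + i)) = (\<Sum>j<m. \<Sum>i<n. f (j * n + i))"
    by (rule sum.swap)
  also have "\<dots> = (\<Sum>i<m * n. f i)"
    by (induction m) (simp_all add: sum_lessThan_add add.commute[of n])
  finally show ?thesis .
qed

text \<open>List counterpart of the index splitting: it identifies the concatenated output blocks
  with one enumeration in increasing order.\<close>

lemma concat_map_blocks:
  "concat (map (\<lambda>p. map (\<lambda>q. f (p * n + q)) [0..<n]) [0..<m]) = map f [0..<m * n]"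
proof (induction m)
  case (Suc m)
  have "map f [0..<m * n + n] = map f [0..<m * n] @ map (\<lambda>q. f (m * n + q)) [0..<n]"
    by (rule nth_equalityI) (auto simp: nth_append)
  then show ?case
    using Suc by (simp add: add.commute[of n])
qed simp

section \<open>Number of blocks\<close>

lemma num_blocks_ge:
  assumes "n > 0"
  shows "l \<le> num_blocks l n * n"
proof -
  have "real l / real n \<le> real (num_blocks l n)"
    unfolding num_blocks_def by linarith
  then have "real l \<le> real (num_blocks l n * n)"
    using assms by (simp add: field_simps)
  then show ?thesis
    by linarith
qed

text \<open>With \<open>l \<le> n2 * n1\<close> this bounds the length of the first transforms by
  \<open>n2\<close>, as their subroutine demands. For \<open>n = 0\<close> the real quotient is 0 by
  convention.\<close>

lemma num_blocks_le:
  assumes "l \<le> M * n"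
  shows "num_blocks l n \<le> M"
proof (cases "n = 0")
  case False
  have "real l \<le> real M * real n"
    using assms by (metis of_nat_le_iff of_nat_mult)
  then have "real l / real n \<le> real M"
    using False by (simp add: field_simps)
  then show ?thesis
    unfolding num_blocks_def by (simp add: ceiling_le_iff)
qed (simp add: num_blocks_def)

text \<open>
  Writing an index as \<open>j = j2 * n1 + j1\<close>, the exponent \<open>j * (r + n2 * s)\<close> splits into the three
  exponents used by the two transforms and the twiddle factor, plus a multiple of \<open>n1 * n2\<close>.
\<close>

lemma two_step_transform:
  fixes \<omega> :: "'a::field"
  assumes root: "\<omega> ^ (n1 * n2) = 1" and a: "length a \<le> m * n1"
  shows "(\<Sum>j1<n1. (\<omega> ^ n2) ^ (s * j1) *
      ((\<Sum>j2<m. (\<omega> ^ n1) ^ (r * j2) * nth_default 0 a (j2 * n1 + j1)) * \<omega> ^ (j1 * r))) =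
    poly (Poly a) (\<omega> ^ (r + n2 * s))"
proof -
  have twiddle: "(\<omega> ^ n2) ^ (s * j1) * ((\<omega> ^ n1) ^ (r * j2) * \<omega> ^ (j1 * r)) =
      (\<omega> ^ (r + n2 * s)) ^ (j2 * n1 + j1)" for j1 j2
  proof -
    have "(\<omega> ^ (r + n2 * s)) ^ (j2 * n1 + j1) =
        \<omega> ^ (n2 * (s * j1) + (n1 * (r * j2) + j1 * r) + n1 * n2 * (s * j2))"
      unfolding power_mult[symmetric] by (rule arg_cong[of _ _ "(^) \<omega>"]) algebra
    also have "\<dots> = \<omega> ^ (n2 * (s * j1) + (n1 * (r * j2) + j1 * r))"
      using root by (simp add: power_add power_mult)
    finally show ?thesis
      by (simp add: power_add power_mult)
  qed
  have "(\<Sum>j1<n1. (\<omega> ^ n2) ^ (s * j1) *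
      ((\<Sum>j2<m. (\<omega> ^ n1) ^ (r * j2) * nth_default 0 a (j2 * n1 + j1)) * \<omega> ^ (j1 * r))) =
    (\<Sum>j1<n1. \<Sum>j2<m. nth_default 0 a (j2 * n1 + j1) * (\<omega> ^ (r + n2 * s)) ^ (j2 * n1 + j1))"
    unfolding twiddle[symmetric] by (simp add: sum_distrib_left sum_distrib_right ac_simps)
  also have "\<dots> = (\<Sum>j<m * n1. nth_default 0 a j * (\<omega> ^ (r + n2 * s)) ^ j)"
    by (rule sum_blocks_mod)
  \<comment> \<open>Indices from \<open>length a\<close> up to \<open>m * n1\<close> only meet the
    zero padding of the last block.\<close>
  also have "\<dots> = (\<Sum>j<length a. a ! j * (\<omega> ^ (r + n2 * s)) ^ j)"
    using a by (intro sum.mono_neutral_cong_right) (auto simp: nth_default_def)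
  finally show ?thesis
    by (simp add: poly_Poly_sum)
qed


section \<open>Execution of generated code\<close>

lemma length_exec [simp]: "length (exec \<omega> x is) = length is"
  unfolding exec_def by (induction "is" rule: rev_induct) auto

lemma exec_snoc: "exec \<omega> x (is @ [i]) = exec \<omega> x is @ [instr_val \<omega> x (exec \<omega> x is) i]"
  by (simp add: exec_def)

text \<open>Execution only appends, so a value once computed keeps its index.\<close>

lemma exec_prefix: "\<exists>rs. exec \<omega> x (is @ js) = exec \<omega> x is @ rs"
proof (induction js rule: rev_induct)
  case (snoc j js)
  then show ?case
    using exec_snoc[of \<omega> x "is @ js" j] by auto
qed simp

section \<open>Assertions about generated code\<close>

lemma operand_ok_mono: "operand_ok m t u \<Longrightarrow> t \<le> t' \<Longrightarrow> operand_ok m t' u"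
  by (cases u) auto

text \<open>Validity of the operand is included so that no lookup is out of range; this is what
  makes the assertion stable when code is appended.\<close>

definition denotes :: "'a::field \<Rightarrow> 'a list \<Rightarrow> instr list \<Rightarrow> operand \<Rightarrow> 'a \<Rightarrow> bool" where
  "denotes \<omega> x is u v \<longleftrightarrow>
     operand_ok (length x) (length is) u \<and> operand_val \<omega> x (exec \<omega> x is) u = v"

lemma denotes_append:
  assumes "denotes \<omega> x is u v"
  shows "denotes \<omega> x (is @ js) u v"
proof -
  obtain rs where "exec \<omega> x (is @ js) = exec \<omega> x is @ rs"
    using exec_prefix by blast
  then show ?thesis
    using assms by (cases u) (auto simp: denotes_def nth_append)
qed

definition valid_code :: "nat \<Rightarrow> instr list \<Rightarrow> bool" where
  "valid_code m is \<longleftrightarrow> (\<forall>t<length is. instr_ok m t (is ! t))"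

lemma valid_code_snoc: "valid_code m (is @ [i]) \<longleftrightarrow> valid_code m is \<and> instr_ok m (length is) i"
  by (auto simp: valid_code_def nth_append less_Suc_eq)

lemma slp_wf_valid_code:
  "slp_wf m P \<longleftrightarrow> valid_code m (instrs P) \<and>
     (\<forall>u\<in>set (outputs P). operand_ok m (length (instrs P)) u)"
  by (simp add: slp_wf_def valid_code_def)

text \<open>A Hoare triple for a fixed initial code: the generator must extend that code, preserve
  its validity and establish \<open>R\<close> for the whole code emitted so far.\<close>

definition generates ::
    "nat \<Rightarrow> instr list \<Rightarrow> 'r gen \<Rightarrow> (instr list \<Rightarrow> 'r \<Rightarrow> bool) \<Rightarrow> bool" where
  "generates m is g R \<longleftrightarrow> (valid_code m is \<longrightarrow>
     (\<exists>r js. run_state g is = (r, is @ js) \<and> valid_code m (is @ js) \<and> R (is @ js) r))"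

lemma generates_return: "R is r \<Longrightarrow> generates m is (State_Monad.return r) R"
  by (auto simp: generates_def)

lemma generates_bind:
  assumes "generates m is g R"
    and "\<And>r js. R (is @ js) r \<Longrightarrow> generates m (is @ js) (h r) S"
  shows "generates m is (State_Monad.bind g h) S"
  unfolding generates_def
proof
  assume "valid_code m is"
  then obtain r js where 1: "run_state g is = (r, is @ js)" "valid_code m (is @ js)" "R (is @ js) r"
    using assms(1) by (auto simp: generates_def)
  with assms(2)[of js r] obtain r' js' where
    "run_state (h r) (is @ js) = (r', is @ js @ js')" "valid_code m (is @ js @ js')"
    "S (is @ js @ js') r'"
    by (auto simp: generates_def)
  then show "\<exists>r js. run_state (State_Monad.bind g h) is = (r, is @ js) \<and>
      valid_code m (is @ js) \<and> S (is @ js) r"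
    using 1 by auto
qed

text \<open>Each body starts from an extension of the initial code that depends on the earlier
  bodies, and each postcondition must outlive the code of the later ones; hence the quantified
  \<open>js\<close> and the monotonicity of \<open>R\<close>.\<close>

lemma generates_traverse_list:
  assumes "\<And>j js. j \<in> set xs \<Longrightarrow> generates m (is @ js) (f j) (R j)"
    and mono: "\<And>j is js r. R j is r \<Longrightarrow> R j (is @ js) r"
  shows "generates m is (State_Monad.traverse_list f xs) (\<lambda>is. list_all2 (\<lambda>j. R j is) xs)"
  using assms(1)
proof (induction xs arbitrary: "is")
  case Nil
  then show ?case
    by (auto intro: generates_return)
next
  case (Cons j xs)
  have f: "generates m is (f j) (R j)"
    using Cons.prems[of j "[]"] by simp
  have tl: "generates m (is @ js) (State_Monad.traverse_list f xs) (\<lambda>is. list_all2 (\<lambda>j. R j is) xs)"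
    for js
    using Cons.prems by (intro Cons.IH) auto
  show ?case
    unfolding State_Monad.traverse_list.simps
    by (rule generates_bind[OF f], rule generates_bind[OF tl], rule generates_return)
      (use mono[of j "is @ _" _ _] in auto)
qed

lemma generates_emit_Mul:
  assumes "denotes \<omega> x is u v" "denotes \<omega> x is u' v'"
  shows "generates (length x) is (emit (Mul u u')) (\<lambda>is r. denotes \<omega> x is r (v * v'))"
  using assms
  by (auto simp: generates_def emit_def valid_code_snoc denotes_def exec_snoc nth_append)

section \<open>Inlining of subroutines\<close>

lemma operand_ok_relocate:
  assumes "operand_ok (length args) t u"
    and "\<And>a. a \<in> set args \<Longrightarrow> operand_ok m r a"
  shows "operand_ok m (r + t) (relocate s r args u)"
  using assms by (cases u) (auto intro: operand_ok_mono[OF _ le_add1])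

lemma instr_ok_relocate:
  assumes "instr_ok (length args) t i"
    and "\<And>a. a \<in> set args \<Longrightarrow> operand_ok m r a"
  shows "instr_ok m (r + t) (relocate_instr s r args i)"
  using assms by (cases i) (auto intro: operand_ok_relocate)

text \<open>Inputs become operands already denoting \<open>ys\<close>, results are shifted past
  those of \<open>is\<close> into \<open>rs\<close>, and \<open>\<omega> ^ (s * e)\<close> is
  \<open>(\<omega> ^ s) ^ e\<close>.\<close>

lemma operand_val_relocate:
  assumes args: "list_all2 (denotes \<omega> x is) args ys"
    and u: "operand_ok (length args) (length rs) u"
  shows "operand_val \<omega> x (exec \<omega> x is @ rs) (relocate s (length is) args u) =
    operand_val (\<omega> ^ s) ys rs u"
proof (cases u)
  case (Input i)
  then have i: "denotes \<omega> x is (args ! i) (ys ! i)"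
    using args u by (auto simp: list_all2_conv_all_nth)
  then show ?thesis
    using Input by (cases "args ! i") (auto simp: denotes_def nth_append)
qed (auto simp: nth_append power_mult)

text \<open>Simulation: the inlined instructions append exactly the trace that the subroutine has on
  its own. The induction runs from the right because execution grows at the end.\<close>

lemma exec_relocate:
  assumes args: "list_all2 (denotes \<omega> x is) args ys"
    and "valid_code (length args) js"
  shows "exec \<omega> x (is @ map (relocate_instr s (length is) args) js) =
    exec \<omega> x is @ exec (\<omega> ^ s) ys js"
  using assms(2)
proof (induction js rule: rev_induct)
  case Nil
  then show ?case
    by (simp add: exec_def)
next
  case (snoc j js)
  have "exec \<omega> x ((is @ map (relocate_instr s (length is) args) js) @
        [relocate_instr s (length is) args j]) =
      exec \<omega> x is @ exec (\<omega> ^ s) ys (js @ [j])"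
    using snoc operand_val_relocate[OF args, of "exec (\<omega> ^ s) ys js" _ s]
    unfolding exec_snoc by (cases j) (auto simp: valid_code_snoc)
  then show ?case
    by simp
qed

lemma valid_code_relocate:
  assumes "valid_code m is" "valid_code (length args) js"
    and "\<And>a. a \<in> set args \<Longrightarrow> operand_ok m (length is) a"
  shows "valid_code m (is @ map (relocate_instr s (length is) args) js)"
  using assms(2)
proof (induction js rule: rev_induct)
  case (snoc j js)
  then show ?case
    using instr_ok_relocate[of args "length js" j m "length is" s, OF _ assms(3)]
      valid_code_snoc[of m "is @ map (relocate_instr s (length is) args) js"]
    by (simp add: valid_code_snoc)
qed (simp add: assms(1))

lemma generates_call:
  assumes P: "slp_wf (length ys) P"
    and args: "list_all2 (denotes \<omega> x is) args ys"
  shows "generates (length x) is (call s P args)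
    (\<lambda>is rs. list_all2 (denotes \<omega> x is) rs (slp_run (\<omega> ^ s) P ys))"
proof -
  have len: "length args = length ys"
    using args by (rule list_all2_lengthD)
  have ok: "operand_ok (length x) (length is) a" if "a \<in> set args" for a
    using that args by (auto simp: list_all2_conv_all_nth in_set_conv_nth denotes_def)
  have code: "valid_code (length args) (instrs P)"
    and outs: "\<And>u. u \<in> set (outputs P) \<Longrightarrow> operand_ok (length args) (length (instrs P)) u"
    using P len by (auto simp: slp_wf_valid_code)
  have "denotes \<omega> x (is @ map (relocate_instr s (length is) args) (instrs P))
      (relocate s (length is) args u) (operand_val (\<omega> ^ s) ys (exec (\<omega> ^ s) ys (instrs P)) u)"
    if "u \<in> set (outputs P)" for u
    using operand_ok_relocate[OF outs[OF that] ok]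
      operand_val_relocate[OF args, of "exec (\<omega> ^ s) ys (instrs P)" u s] outs[OF that]
    by (simp add: denotes_def exec_relocate[OF args code])
  then show ?thesis
    using valid_code_relocate[OF _ code ok]
    by (auto simp: generates_def call_def slp_run_def list_all2_conv_all_nth)
qed

text \<open>The empty code is valid, so a triple starting there becomes a statement about the
  finished program.\<close>

lemma gen_slp_run:
  assumes "generates (length x) [] g (\<lambda>is us. list_all2 (denotes \<omega> x is) us vs)"
  shows "slp_wf (length x) (gen_slp g)" "slp_run \<omega> (gen_slp g) x = vs"
proof -
  obtain us "is" where g: "run_state g [] = (us, is)" "valid_code (length x) is"
    "list_all2 (denotes \<omega> x is) us vs"
    using assms by (auto simp: generates_def valid_code_def)
  then show "slp_wf (length x) (gen_slp g)"
    by (auto simp: gen_slp_def slp_wf_valid_code list_all2_conv_all_nth in_set_conv_nth denotes_def)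
  show "slp_run \<omega> (gen_slp g) x = vs"
    using g by (auto simp: gen_slp_def slp_run_def list_all2_conv_all_nth denotes_def
        intro!: nth_equalityI)
qed


section \<open>Operation counts\<close>

text \<open>The count is the same for every initial code, so costs add up under sequencing without
  knowing which operands were returned.\<close>

definition emits :: "'r gen \<Rightarrow> nat \<Rightarrow> bool" where
  "emits g c \<longleftrightarrow> (\<forall>is. length (snd (run_state g is)) = length is + c)"

lemma emits_return: "emits (State_Monad.return r) 0"
  by (simp add: emits_def)

lemma emits_bind:
  assumes "emits g c" "\<And>r. emits (h r) d"
  shows "emits (State_Monad.bind g h) (c + d)"
  unfolding emits_def
proof
  fix "is"
  show "length (snd (run_state (State_Monad.bind g h) is)) = length is + (c + d)"
    using assms unfolding emits_def
    by (cases "run_state g is") (metis add.assoc case_prod_conv run_state_bind snd_conv)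
qed

lemma emits_traverse_list:
  assumes "\<And>j. emits (f j) c"
  shows "emits (State_Monad.traverse_list f xs) (length xs * c)"
proof (induction xs)
  case Nil
  then show ?case
    by (simp add: emits_return)
next
  case (Cons j xs)
  show ?case
    unfolding State_Monad.traverse_list.simps
    using emits_bind[OF assms[of j] emits_bind[OF Cons emits_return]] by simp
qed

lemma emits_emit: "emits (emit i) 1"
  by (simp add: emits_def emit_def)

lemma emits_call: "emits (call s P args) (slp_ops P)"
  by (simp add: emits_def call_def slp_ops_def)

lemma slp_ops_gen_slp:
  assumes "emits g c"
  shows "slp_ops (gen_slp g) = c"
  using assms by (simp add: emits_def slp_ops_def gen_slp_def split: prod.split)
    (metis add_0 list.size(3) snd_conv)

lemma slp_ops_block_TFT:
  fixes tft k k1 l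
  defines "m \<equiv> num_blocks l (2 ^ k1)"
  shows "slp_ops (block_TFT tft k k1 l) =
    2 ^ k1 * slp_ops (tft (k - k1) m) + (2 ^ k1 * m + m * slp_ops (tft k1 (2 ^ k1)))"
proof -
  show ?thesis
    unfolding block_TFT_def Let_def m_def
    \<comment> \<open>The costs of the stages stay schematic until the rules determine them;
      \<open>trans\<close> leaves the comparison of their sum with the stated one.\<close>
    by (rule slp_ops_gen_slp[OF emits_bind[where d = "_ + _"], THEN trans])
      (rule emits_traverse_list emits_call emits_emit emits_bind emits_return | simp)+
qed

text \<open>The leading terms of the two transform stages carry \<open>k2\<close> and
  \<open>k1\<close> over the same factor \<open>m * 2 ^ k1\<close>, and \<open>k2 + k1 = k\<close>
  merges them.\<close>

lemma block_TFT_ops_bound: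
  assumes tft: "\<And>\<kappa> L. L \<le> 2 ^ \<kappa> \<Longrightarrow>
      real (slp_ops (tft \<kappa> L)) \<le> 3 / 2 * (real L * real \<kappa> + 2 ^ \<kappa>) + 1 / 2"
    and l: "l \<le> 2 ^ k" "2 ^ k1 \<le> l"
  shows "real (slp_ops (block_TFT tft k k1 l)) \<le>
    3 / 2 * real (num_blocks l (2 ^ k1)) * 2 ^ k1 * real k + 5 * 2 ^ k"
proof -
  have "(2::nat) ^ k1 \<le> 2 ^ k"
    using l by linarith
  then have "k1 \<le> k"
    by simp
  then obtain k2 where k: "k = k2 + k1"
    by (metis le_add_diff_inverse2)
  define m where "m = num_blocks l (2 ^ k1)"
  have m: "m \<le> 2 ^ k2"
    unfolding m_def using l(1) k by (intro num_blocks_le) (simp add: power_add)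
  have n: "(2::real) ^ k = 2 ^ k1 * 2 ^ k2"
    by (simp add: k power_add)
  have "real m \<le> 2 ^ k2"
    using m by (metis of_nat_le_iff of_nat_numeral of_nat_power)
  then have mn: "real m * 2 ^ k1 \<le> 2 ^ k"
    unfolding n by simp
  \<comment> \<open>This and the bound on \<open>m\<close> below absorb the additive
    \<open>1 / 2\<close> charged for each call of the subroutine.\<close>
  have "(1::real) \<le> 2 ^ k2"
    by simp
  then have n1: "(2::real) ^ k1 \<le> 2 ^ k"
    unfolding n by simp
  have "real m * 1 \<le> real m * 2 ^ k1"
    by (intro mult_left_mono) auto
  then have m': "real m \<le> 2 ^ k"
    using mn by linarith
  have "2 ^ k1 * real (slp_ops (tft k2 m)) \<le>
      2 ^ k1 * (3 / 2 * (real m * real k2 + 2 ^ k2) + 1 / 2)"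
    using tft[OF m] by (intro mult_left_mono) auto
  also have "\<dots> = 3 / 2 * real m * 2 ^ k1 * real k2 + 3 / 2 * 2 ^ k + 2 ^ k1 / 2"
    by (simp add: n algebra_simps)
  finally have first: "2 ^ k1 * real (slp_ops (tft k2 m)) \<le>
    3 / 2 * real m * 2 ^ k1 * real k2 + 3 / 2 * 2 ^ k + 2 ^ k1 / 2" .
  have "real m * real (slp_ops (tft k1 (2 ^ k1))) \<le>
      real m * (3 / 2 * (2 ^ k1 * real k1 + 2 ^ k1) + 1 / 2)"
    using tft[of "2 ^ k1" k1] by (intro mult_left_mono) auto
  also have "\<dots> = 3 / 2 * real m * 2 ^ k1 * real k1 + 3 / 2 * (real m * 2 ^ k1) + real m / 2"
    by (simp add: algebra_simps)
  finally have second: "real m * real (slp_ops (tft k1 (2 ^ k1))) \<le>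
    3 / 2 * real m * 2 ^ k1 * real k1 + 3 / 2 * (real m * 2 ^ k1) + real m / 2" .
  have "real (slp_ops (block_TFT tft k k1 l)) =
      2 ^ k1 * real (slp_ops (tft k2 m)) +
      (real m * 2 ^ k1 + real m * real (slp_ops (tft k1 (2 ^ k1))))"
    by (simp add: slp_ops_block_TFT k m_def mult.commute)
  \<comment> \<open>With \<open>n = 2 ^ k\<close>, the rest is at most \<open>3/2 n + 1/2 n\<close>
    from the first transforms, \<open>n\<close> from the twiddle factors and
    \<open>3/2 n + 1/2 n\<close> from the second transforms, which gives 5.\<close>
  also have "\<dots> \<le> (3 / 2 * real m * 2 ^ k1 * real k2 + 3 / 2 * real m * 2 ^ k1 * real k1) + 5 * 2 ^ k"
    using first second mn n1 m' by linarith
  also have "\<dots> = 3 / 2 * real m * 2 ^ k1 * real k + 5 * 2 ^ k"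
    by (simp add: k algebra_simps)
  finally show ?thesis
    by (simp add: m_def)
qed


section \<open>Correctness\<close>

text \<open>The operand \<open>Zero\<close> beyond the inputs realizes the convention that missing
  coefficients are 0.\<close>

lemma denotes_coeff_operand:
  "denotes \<omega> a is (coeff_operand (length a) i) (nth_default 0 a i)"
  by (simp add: denotes_def coeff_operand_def nth_default_def)

lemma denotes_Root: "denotes \<omega> x is (Root e) (\<omega> ^ e)"
  by (simp add: denotes_def)

lemma list_all2_denotes_append:
  "list_all2 (denotes \<omega> x is) us vs \<Longrightarrow> list_all2 (denotes \<omega> x (is @ js)) us vs"
  by (erule list_all2_mono) (rule denotes_append)

text \<open>The code is first shown to denote the intermediate vectors of the algorithm; a purely
  algebraic computation then identifies the last of these with values of the polynomial.\<close>

lemma block_TFT_correct: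
  fixes \<omega> :: "'a::field"
  assumes tft: "\<And>\<kappa> L \<theta> :: 'a. primitive_root_of_unity (2 ^ \<kappa>) \<theta> \<Longrightarrow> L \<le> 2 ^ \<kappa> \<Longrightarrow>
      slp_computes_TFT \<kappa> L \<theta> (tft \<kappa> L)"
    and \<omega>: "primitive_root_of_unity (2 ^ k) \<omega>"
    and a: "length a \<le> 2 ^ k" "2 ^ k1 \<le> length a"
  shows "slp_wf (length a) (block_TFT tft k k1 (length a))"
    and "slp_run \<omega> (block_TFT tft k k1 (length a)) a =
      map (\<lambda>i. poly (Poly a) (\<omega> ^ mirror k i)) [0..<num_blocks (length a) (2 ^ k1) * 2 ^ k1]"
proof -
  have "(2::nat) ^ k1 \<le> 2 ^ k"
    using a by linarith
  then have "k1 \<le> k"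
    by simp
  then obtain k2 where k: "k = k2 + k1"
    by (metis le_add_diff_inverse2)
  define n1 n2 :: nat where "n1 = 2 ^ k1" and "n2 = 2 ^ k2"
  define m where "m = num_blocks (length a) n1"
  have n: "(2::nat) ^ k = n1 * n2"
    by (simp add: k n1_def n2_def power_add)
  have m: "m \<le> n2" and am: "length a \<le> m * n1"
    unfolding m_def using a(1) n num_blocks_ge[of n1]
    by (auto simp: n1_def mult.commute intro: num_blocks_le)
  \<comment> \<open>Intended values: \<open>col j1\<close> collects coordinate \<open>j1\<close> of
    all blocks, \<open>b j1\<close> is its transform, \<open>row p\<close> collects coordinate
    \<open>p\<close> of all twiddled vectors, and \<open>c p\<close> is its transform.\<close>
  define col where "col = (\<lambda>j1. map (\<lambda>j2. nth_default 0 a (j2 * n1 + j1)) [0..<m])"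
  define b where "b = (\<lambda>j1. TFT k2 (\<omega> ^ n1) (col j1))"
  define row where "row = (\<lambda>p. map (\<lambda>j1. b j1 ! p * \<omega> ^ (j1 * mirror k2 p)) [0..<n1])"
  define c where "c = (\<lambda>p. TFT k1 (\<omega> ^ n2) (row p))"
  \<comment> \<open>The subroutine applies at \<open>\<omega> ^ n1\<close> because this is a
    primitive root of unity of order \<open>n2\<close>; \<open>T1\<close> is symmetric.\<close>
  have T2: "slp_wf m (tft k2 m)"
    "\<And>x. length x = m \<Longrightarrow> slp_run (\<omega> ^ n1) (tft k2 m) x = TFT k2 (\<omega> ^ n1) x"
    using tft[of k2 "\<omega> ^ n1" m] m \<omega> primitive_root_of_unity_power[of n1 n2 \<omega>]
    by (auto simp: slp_computes_TFT_def n n1_def n2_def)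
  have T1: "slp_wf n1 (tft k1 n1)"
    "\<And>x. length x = n1 \<Longrightarrow> slp_run (\<omega> ^ n2) (tft k1 n1) x = TFT k1 (\<omega> ^ n2) x"
    using tft[of k1 "\<omega> ^ n2" n1] \<omega> primitive_root_of_unity_power[of n2 n1 \<omega>]
    by (auto simp: slp_computes_TFT_def n n1_def n2_def mult.commute)
  have step1: "generates (length a) is
      (call n1 (tft k2 m) (map (\<lambda>j2. coeff_operand (length a) (j2 * n1 + j1)) [0..<m]))
      (\<lambda>is us. list_all2 (denotes \<omega> a is) us (b j1))" for "is" j1
    using generates_call[of "col j1" "tft k2 m" \<omega> a "is" _ n1] T2
    by (simp add: col_def b_def list_all2_conv_all_nth denotes_coeff_operand)
  have step2: "generates (length a) is
      (State_Monad.traverse_list (\<lambda>p. emit (Mul (bhat ! j1 ! p) (Root (j1 * mirror k2 p)))) [0..<m])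
      (\<lambda>is. list_all2 (\<lambda>p u. denotes \<omega> a is u (row p ! j1)) [0..<m])"
    if bhat: "list_all2 (\<lambda>j1 us. list_all2 (denotes \<omega> a is) us (b j1)) [0..<n1] bhat"
      and j1: "j1 < n1" for "is" bhat j1
  proof (rule generates_traverse_list)
    fix p js assume "p \<in> set [0..<m]"
    then have "denotes \<omega> a is (bhat ! j1 ! p) (b j1 ! p)"
      using bhat j1 by (auto simp: list_all2_conv_all_nth b_def col_def TFT_def)
    then show "generates (length a) (is @ js) (emit (Mul (bhat ! j1 ! p) (Root (j1 * mirror k2 p))))
        (\<lambda>is u. denotes \<omega> a is u (row p ! j1))"
      using j1 generates_emit_Mul[OF denotes_append denotes_Root] by (simp add: row_def)
  qed (rule denotes_append)
  have step3: "generates (length a) is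
      (call n2 (tft k1 n1) (map (\<lambda>j1. cs ! j1 ! p) [0..<n1]))
      (\<lambda>is us. list_all2 (denotes \<omega> a is) us (c p))"
    if cs: "list_all2 (\<lambda>j1. list_all2 (\<lambda>p u. denotes \<omega> a is u (row p ! j1)) [0..<m]) [0..<n1] cs"
      and p: "p < m" for "is" cs p
  proof -
    have "length (row p) = n1"
      by (simp add: row_def)
    \<comment> \<open>Stage two stores its results by \<open>j1\<close> first; reading them at a
      fixed \<open>p\<close> is the transposition between the two transforms.\<close>
    moreover from this have
      "list_all2 (denotes \<omega> a is) (map (\<lambda>j1. cs ! j1 ! p) [0..<n1]) (row p)"
      using cs p by (auto simp: list_all2_conv_all_nth)
    ultimately show ?thesis
      using generates_call[of "row p" "tft k1 n1" \<omega> a "is" _ n2] T1 by (simp add: c_def)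
  qed
  have gen: "generates (length a) [] (do {
       bhat \<leftarrow> State_Monad.traverse_list
         (\<lambda>j1. call n1 (tft k2 m) (map (\<lambda>j2. coeff_operand (length a) (j2 * n1 + j1)) [0..<m]))
         [0..<n1];
       c \<leftarrow> State_Monad.traverse_list
         (\<lambda>j1. State_Monad.traverse_list
            (\<lambda>p. emit (Mul (bhat ! j1 ! p) (Root (j1 * mirror k2 p)))) [0..<m])
         [0..<n1];
       chat \<leftarrow> State_Monad.traverse_list
         (\<lambda>p. call n2 (tft k1 n1) (map (\<lambda>j1. c ! j1 ! p) [0..<n1]))
         [0..<m];
       State_Monad.return (concat chat)
     }) (\<lambda>is us. list_all2 (denotes \<omega> a is) us (concat (map c [0..<m])))"
  proof (rule generates_bind[where
        R = "\<lambda>is. list_all2 (\<lambda>j1 us. list_all2 (denotes \<omega> a is) us (b j1)) [0..<n1]"], goal_cases)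
    case 1
    show ?case
      by (rule generates_traverse_list) (rule step1, rule list_all2_denotes_append)
  next
    case (2 bhat is1)
    show ?case
    proof (rule generates_bind[where R = "\<lambda>is. list_all2
          (\<lambda>j1. list_all2 (\<lambda>p u. denotes \<omega> a is u (row p ! j1)) [0..<m]) [0..<n1]"], goal_cases)
      case 1
      show ?case
      proof (rule generates_traverse_list, goal_cases)
        case (1 j1 js)
        \<comment> \<open>Facts about \<open>bhat\<close> were established before the code
          \<open>js\<close> of earlier iterations and are carried over it.\<close>
        with 2 show ?case
          by (intro step2) (auto elim!: list_all2_mono intro: denotes_append)
      qed (erule list_all2_mono, rule denotes_append)
    next
      case (2 cs is2)
      note cs = this
      show ?case
      proof (rule generates_bind[where
            R = "\<lambda>is. list_all2 (\<lambda>p us. list_all2 (denotes \<omega> a is) us (c p)) [0..<m]"], goal_cases)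
        case 1
        show ?case
        proof (rule generates_traverse_list, goal_cases)
          case (1 p js)
          with cs show ?case
            by (intro step3) (auto elim!: list_all2_mono intro: denotes_append
                simp del: append_assoc)
        qed (rule list_all2_denotes_append)
      next
        case (2 chat is3)
        \<comment> \<open>Restated as a relation between two lists of lists, the assertion passes
          through \<open>concat\<close> by relational parametricity.\<close>
        then have "list_all2 (list_all2 (denotes \<omega> a ((([] @ is1) @ is2) @ is3))) chat (map c [0..<m])"
          by (auto simp: list_all2_conv_all_nth)
        then show ?case
          by (intro generates_return) (rule concat_transfer[THEN rel_funD])
      qed
    qed
  qed
  have c: "c p = map (\<lambda>q. poly (Poly a) (\<omega> ^ mirror k (p * n1 + q))) [0..<n1]" if p: "p < m" for p
  proof -
    have "dft_coeff (\<omega> ^ n2) (row p) (mirror k1 q) =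
        poly (Poly a) (\<omega> ^ mirror k (p * n1 + q))" if "q < n1" for q
      \<comment> \<open>By \<open>mirror_block\<close> the exponent
        \<open>mirror k2 p + n2 * mirror k1 q\<close> is the bit reversal of
        \<open>p * n1 + q\<close>.\<close>
      using two_step_transform[of \<omega> n1 n2 a m "mirror k1 q" "mirror k2 p"] \<omega> n am p that
      by (simp add: dft_coeff_def row_def b_def TFT_def col_def primitive_root_of_unity_def
          n1_def n2_def k mirror_block)
    then show ?thesis
      by (simp add: c_def TFT_def row_def)
  qed
  have "concat (map c [0..<m]) =
      concat (map (\<lambda>p. map (\<lambda>q. poly (Poly a) (\<omega> ^ mirror k (p * n1 + q))) [0..<n1]) [0..<m])"
    by (intro arg_cong[of _ _ concat] map_cong refl c) simp
  then have out: "concat (map c [0..<m]) = map (\<lambda>i. poly (Poly a) (\<omega> ^ mirror k i)) [0..<m * n1]"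
    by (simp only: concat_map_blocks[where f = "\<lambda>i. poly (Poly a) (\<omega> ^ mirror k i)"])
  have k2: "k - k1 = k2"
    by (simp add: k)
  show "slp_wf (length a) (block_TFT tft k k1 (length a))"
    using gen_slp_run(1)[OF gen]
    unfolding block_TFT_def Let_def k2 n1_def[symmetric] n2_def[symmetric] m_def[symmetric] .
  show "slp_run \<omega> (block_TFT tft k k1 (length a)) a =
      map (\<lambda>i. poly (Poly a) (\<omega> ^ mirror k i)) [0..<num_blocks (length a) (2 ^ k1) * 2 ^ k1]"
    using gen_slp_run(2)[OF gen]
    unfolding block_TFT_def Let_def k2 n1_def[symmetric] n2_def[symmetric] m_def[symmetric] out .
qed

theorem proposition15:
  shows
    "(\<forall>tft :: nat \<Rightarrow> nat \<Rightarrow> slp.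
        (\<forall>\<kappa> L. \<forall>\<theta> :: 'a::field. primitive_root_of_unity (2 ^ \<kappa>) \<theta> \<and> L \<le> 2 ^ \<kappa> \<longrightarrow>
           slp_computes_TFT \<kappa> L \<theta> (tft \<kappa> L)) \<longrightarrow>
        (\<forall>k k1 l. \<forall>\<omega> :: 'a. \<forall>a :: 'a list.
           primitive_root_of_unity (2 ^ k) \<omega> \<and> 1 \<le> l \<and> l \<le> 2 ^ k \<and> length a = l \<and>
           2 ^ k1 \<le> l \<longrightarrow>
             slp_wf l (block_TFT tft k k1 l) \<and>
             slp_run \<omega> (block_TFT tft k k1 l) a =
               map (\<lambda>i. poly (Poly a) (\<omega> ^ mirror k i)) [0..<num_blocks l (2 ^ k1) * 2 ^ k1])) \<and>
     (\<exists>C :: real. \<forall>tft :: nat \<Rightarrow> nat \<Rightarrow> slp.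
        (\<forall>\<kappa> L. L \<le> 2 ^ \<kappa> \<longrightarrow>
           real (slp_ops (tft \<kappa> L)) \<le> 3 / 2 * (real L * real \<kappa> + 2 ^ \<kappa>) + 1 / 2) \<longrightarrow>
        (\<forall>k k1 l. 1 \<le> l \<and> l \<le> 2 ^ k \<and> 2 ^ k1 \<le> l \<longrightarrow>
           real (slp_ops (block_TFT tft k k1 l)) \<le>
             3 / 2 * real (num_blocks l (2 ^ k1)) * 2 ^ k1 * real k + C * 2 ^ k))"
\<comment> \<open>The witness 5 is the constant of \<open>block_TFT_ops_bound\<close>.\<close>
proof (intro conjI exI[of _ 5] allI impI; (elim conjE)?)
  fix tft k k1 l and \<omega> :: 'a and a :: "'a list"
  assume "\<forall>\<kappa> L. \<forall>\<theta> :: 'a. primitive_root_of_unity (2 ^ \<kappa>) \<theta> \<and> L \<le> 2 ^ \<kappa> \<longrightarrow>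
      slp_computes_TFT \<kappa> L \<theta> (tft \<kappa> L)"
    and \<omega>: "primitive_root_of_unity (2 ^ k) \<omega>" "l \<le> 2 ^ k" "length a = l" "2 ^ k1 \<le> l"
  then have tft: "\<And>\<kappa> L \<theta> :: 'a. primitive_root_of_unity (2 ^ \<kappa>) \<theta> \<Longrightarrow> L \<le> 2 ^ \<kappa> \<Longrightarrow>
      slp_computes_TFT \<kappa> L \<theta> (tft \<kappa> L)"
    by simp
  show "slp_wf l (block_TFT tft k k1 l)"
    using block_TFT_correct(1)[OF tft \<omega>(1), where a = a] \<omega> by simp
  show "slp_run \<omega> (block_TFT tft k k1 l) a =
      map (\<lambda>i. poly (Poly a) (\<omega> ^ mirror k i)) [0..<num_blocks l (2 ^ k1) * 2 ^ k1]"
    using block_TFT_correct(2)[OF tft \<omega>(1), where a = a] \<omega> by simp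
qed (rule block_TFT_ops_bound, simp_all)

end
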